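(* Let $G$ be a group of homeomorphisms of a locally compact topological space $X$ such that $X/G$ is compact, and let $R$ be a fundamental region for the action of $G$ on $X$. Then the following are equivalent: (1) $R$ is locally finite; (2) $R$ is strongly locally finite; (3) $\overline R$ has a neighbourhood $U$ that is met by $gU$ for only finitely many $g\in G$. Moreover, if $R$ is locally finite, then $\overline R$ is compact. If, in addition, $G$ acts properly discontinuously and $X$ is first countable and Hausdorff, then the converse holds, i.e., if $\overline R$ is compact, then $R$ is locally finite.
   Context: $X/G$ is the orbit space with the quotient (final) topology. $X$ is locally compact if every point has a compact neighbourhood; $X$ is not assumed Hausdorff unless stated. Two sets meet if their intersection is non-empty. $\overline R$ denotes the closure of $R$ in $X$. The action is properly discontinuous if any two points $x,y\in X$ have open neighbourhoods $U$ of $x$ and $V$ of $y$ such that $gU$ meets $V$ for only finitely many $g\in G$. An open set $R\subset X$ is a fundamental region for the action if (i) whenever $gR$ meets $R$ for $g\in G$, then $g$ is the identity, and (ii) $\bigcup_{g\in G}g\overline R=X$. A family of sets $\{A_g\}_{g\in G}$ in $X$ is locally finite if every point of $X$ has an open neighbourhood that meets $A_g$ for only finitely many $g\in G$. A fundamental region $R$ is locally finite if $\{g\overline R\}_{g\in G}$ is a locally finite family. It is strongly locally finite if $\overline R$ has an open neighbourhood $U$ such that $\{gU\}_{g\in G}$ is a locally finite family. *)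

theory Defs
  imports "HOL-Analysis.Analysis" "HOL-Algebra.Group_Action"
begin

text \<open>
  Spaces are abstract topologies, so no separation axiom is built in.
  A group of homeomorphisms is a set of maps forming a subgroup of \<open>BijGroup (topspace X)\<close>.
  Elements of \<open>BijGroup\<close> are extensional, i.e. determined by their values on
  \<open>topspace X\<close>; hence counting elements of \<open>G\<close> counts homeomorphisms, and the identity of
  the group is \<open>\<lambda>x\<in>topspace X. x\<close>.
\<close>

definition homeomorphism_group :: "'a topology \<Rightarrow> ('a \<Rightarrow> 'a) set \<Rightarrow> bool" where
  "homeomorphism_group X G \<longleftrightarrow>
     subgroup G (BijGroup (topspace X)) \<and> (\<forall>g\<in>G. homeomorphic_map X X g)"

definition orbit_map :: "'a topology \<Rightarrow> ('a \<Rightarrow> 'a) set \<Rightarrow> 'a \<Rightarrow> 'a set" where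
  "orbit_map X G = orbit ((BijGroup (topspace X))\<lparr>carrier := G\<rparr>) (\<lambda>g. g)"

lemma orbit_map_eq: "orbit_map X G x = (\<lambda>g. g x) ` G"
  by (auto simp: orbit_map_def orbit_def)

definition orbit_space :: "'a topology \<Rightarrow> ('a \<Rightarrow> 'a) set \<Rightarrow> 'a set topology" where
  "orbit_space X G =
     topology (\<lambda>W. W \<subseteq> orbit_map X G ` topspace X \<and>
                   openin X {x \<in> topspace X. orbit_map X G x \<in> W})"

lemma openin_orbit_space:
  "openin (orbit_space X G) W \<longleftrightarrow>
     W \<subseteq> orbit_map X G ` topspace X \<and> openin X {x \<in> topspace X. orbit_map X G x \<in> W}"
proof -
  let ?P = "\<lambda>W. W \<subseteq> orbit_map X G ` topspace X \<and>
                openin X {x \<in> topspace X. orbit_map X G x \<in> W}"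
  have "?P (S \<inter> T)" if "?P S" "?P T" for S T
  proof -
    have "{x \<in> topspace X. orbit_map X G x \<in> S \<inter> T} =
          {x \<in> topspace X. orbit_map X G x \<in> S} \<inter> {x \<in> topspace X. orbit_map X G x \<in> T}"
      by auto
    moreover have "openin X \<dots>"
      using that by (intro openin_Int) auto
    ultimately show ?thesis
      using that(1) by (simp only:) (auto intro: le_infI1)
  qed
  moreover have "?P (\<Union>\<K>)" if "\<forall>K\<in>\<K>. ?P K" for \<K>
  proof -
    have "{x \<in> topspace X. orbit_map X G x \<in> \<Union>\<K>} =
          (\<Union>K\<in>\<K>. {x \<in> topspace X. orbit_map X G x \<in> K})"
      by auto
    moreover have "openin X (\<Union>K\<in>\<K>. {x \<in> topspace X. orbit_map X G x \<in> K})"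
      using that by (intro openin_Union) auto
    ultimately show ?thesis
      using that by (simp only:) (simp add: Sup_le_iff)
  qed
  ultimately have "istopology ?P"
    unfolding istopology_def by (intro conjI allI impI) simp_all
  then show ?thesis
    unfolding orbit_space_def by (simp add: topology_inverse')
qed

lemma topspace_orbit_space: "topspace (orbit_space X G) = orbit_map X G ` topspace X"
proof -
  have "{x \<in> topspace X. orbit_map X G x \<in> orbit_map X G ` topspace X} = topspace X"
    by auto
  then have "openin (orbit_space X G) (orbit_map X G ` topspace X)"
    by (simp add: openin_orbit_space)
  then show ?thesis
    using openin_orbit_space[of X G "topspace (orbit_space X G)"] openin_subset by (intro subset_antisym) auto
qed

lemma quotient_map_orbit_space: "quotient_map X (orbit_space X G) (orbit_map X G)"
  by (auto simp: quotient_map_def topspace_orbit_space openin_orbit_space)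

definition properly_discontinuous :: "'a topology \<Rightarrow> ('a \<Rightarrow> 'a) set \<Rightarrow> bool" where
  "properly_discontinuous X G \<longleftrightarrow>
     (\<forall>x\<in>topspace X. \<forall>y\<in>topspace X. \<exists>U V. openin X U \<and> x \<in> U \<and> openin X V \<and> y \<in> V \<and>
        finite {g \<in> G. g ` U \<inter> V \<noteq> {}})"

definition fundamental_region :: "'a topology \<Rightarrow> ('a \<Rightarrow> 'a) set \<Rightarrow> 'a set \<Rightarrow> bool" where
  "fundamental_region X G R \<longleftrightarrow>
     openin X R \<and>
     (\<forall>g\<in>G. g ` R \<inter> R \<noteq> {} \<longrightarrow> g = \<one>\<^bsub>BijGroup (topspace X)\<^esub>) \<and>
     (\<Union>g\<in>G. g ` (X closure_of R)) = topspace X"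

text \<open>
  Unlike \<open>locally_finite_in\<close>, which concerns a set of sets, this counts indices, so
  repetitions in the family matter.
\<close>

definition locally_finite_family :: "'a topology \<Rightarrow> 'i set \<Rightarrow> ('i \<Rightarrow> 'a set) \<Rightarrow> bool" where
  "locally_finite_family X I A \<longleftrightarrow>
     (\<forall>x\<in>topspace X. \<exists>U. openin X U \<and> x \<in> U \<and> finite {i \<in> I. U \<inter> A i \<noteq> {}})"

definition locally_finite_region :: "'a topology \<Rightarrow> ('a \<Rightarrow> 'a) set \<Rightarrow> 'a set \<Rightarrow> bool" where
  "locally_finite_region X G R \<longleftrightarrow> locally_finite_family X G (\<lambda>g. g ` (X closure_of R))"

definition strongly_locally_finite_region :: "'a topology \<Rightarrow> ('a \<Rightarrow> 'a) set \<Rightarrow> 'a set \<Rightarrow> bool" where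
  "strongly_locally_finite_region X G R \<longleftrightarrow>
     (\<exists>U. openin X U \<and> X closure_of R \<subseteq> U \<and> locally_finite_family X G (\<lambda>g. g ` U))"

text \<open>Neighbourhoods of sets need not be open.\<close>

definition neighbourhood_of_set :: "'a topology \<Rightarrow> 'a set \<Rightarrow> 'a set \<Rightarrow> bool" where
  "neighbourhood_of_set X A U \<longleftrightarrow>
     U \<subseteq> topspace X \<and> (\<exists>W. openin X W \<and> A \<subseteq> W \<and> W \<subseteq> U)"

end

theory Submission
  imports Defs
begin

text \<open>
  Write \<open>C\<close> for the closure of \<open>R\<close>. Everything follows from one observation: if the
  translates of \<open>C\<close> form a locally finite family, then, since they cover \<open>X\<close>, the action is
  proper in the sense that \<open>g L\<close> meets \<open>M\<close> for only finitely many \<open>g\<close> whenever \<open>L\<close> and \<open>M\<close>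
  are compact (\<open>finite_translates_between_compacts\<close>). Indeed \<open>L\<close> meets only finitely many
  translates \<open>h C\<close>, \<open>M\<close> meets only finitely many \<open>k C\<close>, and a point of \<open>L\<close> in \<open>h C\<close> that \<open>g\<close>
  carries into \<open>M\<close> forces \<open>g h\<close> to be one of the \<open>k\<close>.

  Compactness of the orbit space yields a compact set \<open>K\<close> whose translates cover \<open>X\<close>
  (\<open>compact_set_meeting_all_orbits\<close>). If \<open>R\<close> is locally finite, \<open>K\<close> meets only finitely many
  translates of \<open>C\<close>, so \<open>C\<close> is covered by finitely many translates of \<open>K\<close>, and as a closed
  subset of their union it is compact. By local compactness \<open>C\<close> then has an open
  neighbourhood \<open>U\<close> contained in a compact set \<open>L\<close>. Comparing
  \<open>L\<close> with a compact neighbourhood of a point shows that \<open>R\<close> is strongly locally finite, and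
  comparing \<open>L\<close> with itself shows that \<open>g U\<close> meets \<open>U\<close> for only finitely many \<open>g\<close>. In the
  other direction, a neighbourhood of \<open>C\<close> of the latter kind can be translated to any point
  of \<open>X\<close>, again because the translates of \<open>C\<close> cover \<open>X\<close>.

  Finally, proper discontinuity for pairs of points passes to a point and a compact set
  by taking a finite subcover; for the compact set \<open>C\<close> the result is local finiteness.
\<close>

section \<open>Compact sets in abstract topologies\<close>

lemma compactin_finite_subcover:
  assumes "compactin X K"
    and "\<And>x. x \<in> K \<Longrightarrow> openin X (U x) \<and> x \<in> U x"
  obtains F where "finite F" "F \<subseteq> K" "K \<subseteq> (\<Union>x\<in>F. U x)"
proof -
  have "(\<forall>V\<in>U ` K. openin X V) \<and> K \<subseteq> \<Union>(U ` K)"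
    using assms(2) by blast
  then obtain \<F> where "finite \<F>" "\<F> \<subseteq> U ` K" "K \<subseteq> \<Union>\<F>"
    using assms(1) unfolding compactin_def by meson
  then show thesis
    using that by (metis finite_subset_image)
qed

lemma locally_finite_family_meets_compact:
  assumes "locally_finite_family X I A" "compactin X K"
  shows "finite {i \<in> I. K \<inter> A i \<noteq> {}}"
proof -
  have "\<forall>x\<in>K. \<exists>U. openin X U \<and> x \<in> U \<and> finite {i \<in> I. U \<inter> A i \<noteq> {}}"
    using assms compactin_subset_topspace unfolding locally_finite_family_def by blast
  then obtain U where U: "\<And>x. x \<in> K \<Longrightarrow>
      openin X (U x) \<and> x \<in> U x \<and> finite {i \<in> I. U x \<inter> A i \<noteq> {}}"
    by metis
  obtain F where F: "finite F" "F \<subseteq> K" "K \<subseteq> (\<Union>x\<in>F. U x)"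
    using compactin_finite_subcover[of X K U] assms(2) U by metis
  have "finite (\<Union>x\<in>F. {i \<in> I. U x \<inter> A i \<noteq> {}})"
    using F U by blast
  moreover have "{i \<in> I. K \<inter> A i \<noteq> {}} \<subseteq> (\<Union>x\<in>F. {i \<in> I. U x \<inter> A i \<noteq> {}})"
    using F(3) by blast
  ultimately show ?thesis
    by (rule rev_finite_subset)
qed

lemma compact_neighbourhood_of_compact:
  assumes "locally_compact_space X" "compactin X K"
  obtains U L where "openin X U" "compactin X L" "K \<subseteq> U" "U \<subseteq> L"
proof -
  have "\<forall>x\<in>K. \<exists>U L. openin X U \<and> compactin X L \<and> x \<in> U \<and> U \<subseteq> L"
    using assms compactin_subset_topspace unfolding locally_compact_space_def by blast
  then obtain U L where UL: "\<And>x. x \<in> K \<Longrightarrow>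
      openin X (U x) \<and> compactin X (L x) \<and> x \<in> U x \<and> U x \<subseteq> L x"
    by metis
  obtain F where F: "finite F" "F \<subseteq> K" "K \<subseteq> (\<Union>x\<in>F. U x)"
    using compactin_finite_subcover[of X K U] assms(2) UL by metis
  show thesis
  proof
    show "openin X (\<Union>x\<in>F. U x)" "(\<Union>x\<in>F. U x) \<subseteq> (\<Union>x\<in>F. L x)"
      using F UL by blast+
    show "compactin X (\<Union>x\<in>F. L x)"
      by (rule compactin_Union) (use F UL in auto)
  qed (rule F(3))
qed

section \<open>Groups of homeomorphisms\<close>

locale homeomorphism_action =
  fixes X :: "'a topology" and G :: "('a \<Rightarrow> 'a) set"
  assumes homeomorphism_group: "homeomorphism_group X G"
begin

abbreviation action_mult (infixl "\<cdot>" 70) where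
  "g \<cdot> h \<equiv> g \<otimes>\<^bsub>BijGroup (topspace X)\<^esub> h"

abbreviation action_inv where
  "action_inv g \<equiv> inv\<^bsub>BijGroup (topspace X)\<^esub> g"

interpretation Bij: group "BijGroup (topspace X)"
  by (rule group_BijGroup)

lemma homeomorphic: "g \<in> G \<Longrightarrow> homeomorphic_map X X g"
  using homeomorphism_group by (simp add: homeomorphism_group_def)

lemma subgroup_G: "subgroup G (BijGroup (topspace X))"
  using homeomorphism_group by (simp add: homeomorphism_group_def)

lemma in_carrier: "g \<in> G \<Longrightarrow> g \<in> carrier (BijGroup (topspace X))"
  using subgroup_G by (rule subgroup.mem_carrier)

lemma mult_closed: "g \<in> G \<Longrightarrow> h \<in> G \<Longrightarrow> g \<cdot> h \<in> G"
  using subgroup_G by (rule subgroup.m_closed)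

lemma inv_closed: "g \<in> G \<Longrightarrow> action_inv g \<in> G"
  using subgroup_G by (rule subgroup.m_inv_closed)

lemma maps_topspace: "g \<in> G \<Longrightarrow> x \<in> topspace X \<Longrightarrow> g x \<in> topspace X"
  using homeomorphic homeomorphic_imp_surjective_map by blast

lemma mult_apply:
  assumes "g \<in> G" "h \<in> G" "x \<in> topspace X"
  shows "(g \<cdot> h) x = g (h x)"
  using in_carrier[OF assms(1)] in_carrier[OF assms(2)] assms(3)
  by (simp add: BijGroup_def compose_eq)

lemma one_apply: "x \<in> topspace X \<Longrightarrow> \<one>\<^bsub>BijGroup (topspace X)\<^esub> x = x"
  by (simp add: BijGroup_def)

lemma inv_apply:
  assumes "g \<in> G" "x \<in> topspace X"
  shows "action_inv g (g x) = x"
  using mult_apply[OF inv_closed[OF assms(1)] assms] in_carrier[OF assms(1)]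
  by (simp add: one_apply assms(2))

lemma orbit_map_translate:
  assumes "g \<in> G" "x \<in> topspace X"
  shows "orbit_map X G (g x) = orbit_map X G x"
proof -
  have "k (g x) \<in> (\<lambda>k. k x) ` G" if "k \<in> G" for k
    using mult_apply[OF that assms] mult_closed[OF that assms(1)] by (metis imageI)
  moreover have "k x \<in> (\<lambda>k. k (g x)) ` G" if "k \<in> G" for k
  proof -
    have "(k \<cdot> action_inv g) (g x) = k x"
      using mult_apply[OF that inv_closed[OF assms(1)] maps_topspace[OF assms]]
      by (simp add: inv_apply assms)
    then show ?thesis
      using mult_closed[OF that inv_closed[OF assms(1)]] by (metis imageI)
  qed
  ultimately show ?thesis
    by (auto simp: orbit_map_eq)
qed

lemma orbit_map_eq_iff:
  assumes "x \<in> topspace X" "y \<in> topspace X"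
  shows "orbit_map X G x = orbit_map X G y \<longleftrightarrow> (\<exists>g\<in>G. x = g y)"
proof
  assume "orbit_map X G x = orbit_map X G y"
  moreover have "x \<in> orbit_map X G x"
    using subgroup.one_closed[OF subgroup_G] one_apply[OF assms(1)]
    unfolding orbit_map_eq by (metis imageI)
  ultimately show "\<exists>g\<in>G. x = g y"
    by (auto simp: orbit_map_eq)
next
  assume "\<exists>g\<in>G. x = g y"
  then show "orbit_map X G x = orbit_map X G y"
    using orbit_map_translate assms(2) by blast
qed

text \<open>The preimage of the image of an open set is the union of its translates.\<close>

lemma open_map_orbit_map: "open_map X (orbit_space X G) (orbit_map X G)"
  unfolding open_map_def
proof (intro allI impI)
  fix U assume U: "openin X U"
  then have sub: "U \<subseteq> topspace X"
    by (rule openin_subset)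
  have "x \<in> topspace X \<and> orbit_map X G x \<in> orbit_map X G ` U \<longleftrightarrow> x \<in> (\<Union>g\<in>G. g ` U)" for x
  proof
    assume "x \<in> topspace X \<and> orbit_map X G x \<in> orbit_map X G ` U"
    then obtain u where "u \<in> U" "x \<in> topspace X" "orbit_map X G x = orbit_map X G u"
      by blast
    then show "x \<in> (\<Union>g\<in>G. g ` U)"
      using orbit_map_eq_iff[of x u] sub by blast
  next
    assume "x \<in> (\<Union>g\<in>G. g ` U)"
    then obtain g u where gu: "g \<in> G" "u \<in> U" "x = g u"
      by blast
    then have "u \<in> topspace X"
      using sub by blast
    with gu show "x \<in> topspace X \<and> orbit_map X G x \<in> orbit_map X G ` U"
      using maps_topspace[of g u] orbit_map_translate[of g u] by blast
  qed
  then have "{x \<in> topspace X. orbit_map X G x \<in> orbit_map X G ` U} = (\<Union>g\<in>G. g ` U)"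
    by blast
  moreover have "openin X (g ` U)" if "g \<in> G" for g
    using homeomorphic_map_openness[OF homeomorphic[OF that] sub] U by simp
  ultimately show "openin (orbit_space X G) (orbit_map X G ` U)"
    using sub by (auto simp: openin_orbit_space)
qed

text \<open>
  The orbit map is open, so the interiors of compact sets have open images. Finitely many of
  these images cover the compact orbit space, and the union of the compact sets is \<open>K\<close>.
\<close>

lemma compact_set_meeting_all_orbits:
  assumes "locally_compact_space X" "compact_space (orbit_space X G)"
  obtains K where "compactin X K" "topspace X = (\<Union>g\<in>G. g ` K)"
proof -
  define \<U> where
    "\<U> = {orbit_map X G ` U | U. openin X U \<and> (\<exists>L. compactin X L \<and> U \<subseteq> L)}"
  have "\<forall>W\<in>\<U>. openin (orbit_space X G) W"
    using open_map_orbit_map by (auto simp: \<U>_def open_map_def)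
  moreover have "orbit_map X G x \<in> \<Union>\<U>" if x: "x \<in> topspace X" for x
  proof -
    obtain U L where UL: "openin X U" "compactin X L" "x \<in> U" "U \<subseteq> L"
      using assms(1) x unfolding locally_compact_space_def by blast
    then have "orbit_map X G ` U \<in> \<U>"
      unfolding \<U>_def by blast
    then show ?thesis
      using UL(3) by blast
  qed
  then have "topspace (orbit_space X G) \<subseteq> \<Union>\<U>"
    unfolding topspace_orbit_space by (rule image_subsetI)
  ultimately obtain \<F> where \<F>: "finite \<F>" "\<F> \<subseteq> \<U>" "topspace (orbit_space X G) \<subseteq> \<Union>\<F>"
    using assms(2) unfolding compact_space_alt by meson
  have "\<exists>L. compactin X L \<and> W \<subseteq> orbit_map X G ` L" if W: "W \<in> \<F>" for W
  proof -
    have "W \<in> \<U>"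
      using W \<F>(2) by blast
    then obtain U L where "W = orbit_map X G ` U" "compactin X L" "U \<subseteq> L"
      unfolding \<U>_def by blast
    then show ?thesis
      by (metis image_mono)
  qed
  then obtain L where L: "\<And>W. W \<in> \<F> \<Longrightarrow> compactin X (L W) \<and> W \<subseteq> orbit_map X G ` L W"
    by metis
  have K: "compactin X (\<Union>W\<in>\<F>. L W)"
    by (rule compactin_Union) (use \<F>(1) L in auto)
  have "x \<in> (\<Union>g\<in>G. g ` (\<Union>W\<in>\<F>. L W))" if x: "x \<in> topspace X" for x
  proof -
    obtain W where W: "W \<in> \<F>" "orbit_map X G x \<in> W"
      using \<F>(3) x by (auto simp: topspace_orbit_space)
    then obtain y where y: "y \<in> L W" "orbit_map X G x = orbit_map X G y"
      using L by blast
    have "y \<in> topspace X"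
      using y(1) compactin_subset_topspace[of X "L W"] L[OF W(1)] by blast
    then obtain g where "g \<in> G" "x = g y"
      using orbit_map_eq_iff[OF x] y(2) by blast
    then show ?thesis
      using W(1) y(1) by blast
  qed
  moreover have "(\<Union>g\<in>G. g ` (\<Union>W\<in>\<F>. L W)) \<subseteq> topspace X"
    using compactin_subset_topspace[OF K] maps_topspace by blast
  ultimately show thesis
    using that[OF K] by blast
qed

section \<open>Locally finite covers by translates\<close>

text \<open>
  If \<open>l \<in> L\<close> lies in \<open>h C\<close> and \<open>g l \<in> M\<close>, then \<open>M\<close> meets \<open>(g h) C\<close>. Hence \<open>g = (g h) h\<^sup>-\<^sup>1\<close>, where
  both \<open>h\<close> and \<open>g h\<close> range over finite sets.
\<close>

lemma finite_translates_between_compacts: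
  assumes cover: "(\<Union>g\<in>G. g ` C) = topspace X" and "C \<subseteq> topspace X"
    and lf: "locally_finite_family X G (\<lambda>g. g ` C)"
    and L: "compactin X L" and M: "compactin X M"
  shows "finite {g \<in> G. g ` L \<inter> M \<noteq> {}}"
proof -
  let ?H = "{h \<in> G. L \<inter> h ` C \<noteq> {}}" and ?K = "{k \<in> G. M \<inter> k ` C \<noteq> {}}"
  have "g \<in> (\<lambda>(k, h). k \<cdot> action_inv h) ` (?K \<times> ?H)"
    if g: "g \<in> G" and meets: "g ` L \<inter> M \<noteq> {}" for g
  proof -
    obtain l where l: "l \<in> L" "g l \<in> M"
      using meets by blast
    then obtain h c where hc: "h \<in> G" "c \<in> C" "l = h c"
      using cover compactin_subset_topspace[OF L] by blast
    then have "(g \<cdot> h) c = g l"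
      using mult_apply g assms(2) by blast
    then have "g \<cdot> h \<in> ?K"
      using mult_closed[OF g hc(1)] hc(2) l(2) by (metis (mono_tags, lifting) CollectI IntI empty_iff imageI)
    moreover have "h \<in> ?H"
      using hc l(1) by blast
    ultimately have "(g \<cdot> h, h) \<in> ?K \<times> ?H"
      by simp
    moreover have "g = (g \<cdot> h) \<cdot> action_inv h"
      using in_carrier[OF g] in_carrier[OF hc(1)] by (simp add: Bij.m_assoc)
    ultimately show ?thesis
      by (metis (no_types, lifting) case_prod_conv image_eqI)
  qed
  then have "{g \<in> G. g ` L \<inter> M \<noteq> {}} \<subseteq> (\<lambda>(k, h). k \<cdot> action_inv h) ` (?K \<times> ?H)"
    by blast
  moreover have "finite (?K \<times> ?H)"
    using locally_finite_family_meets_compact[OF lf] L M by simp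
  ultimately show ?thesis
    by (meson finite_imageI finite_subset)
qed

text \<open>
  A compact set \<open>K\<close> with \<open>G K = X\<close> meets only finitely many \<open>h C\<close>, and the corresponding
  finitely many \<open>h\<^sup>-\<^sup>1 K\<close> already cover \<open>C\<close>.
\<close>

lemma locally_finite_imp_compact:
  assumes "locally_compact_space X" "compact_space (orbit_space X G)"
    and C: "closedin X C" and lf: "locally_finite_family X G (\<lambda>g. g ` C)"
  shows "compactin X C"
proof -
  obtain K where K: "compactin X K" "topspace X = (\<Union>g\<in>G. g ` K)"
    using compact_set_meeting_all_orbits assms(1,2) by blast
  let ?H = "{h \<in> G. K \<inter> h ` C \<noteq> {}}"
  have "compactin X (\<Union>h\<in>?H. action_inv h ` K)"
  proof (rule compactin_Union)
    show "finite ((\<lambda>h. action_inv h ` K) ` ?H)"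
      using locally_finite_family_meets_compact[OF lf K(1)] by simp
    show "compactin X S" if S: "S \<in> (\<lambda>h. action_inv h ` K) ` ?H" for S
    proof -
      obtain h where h: "h \<in> G" "S = action_inv h ` K"
        using S by blast
      have "continuous_map X X (action_inv h)"
        using homeomorphic[OF inv_closed[OF h(1)]] by (rule homeomorphic_imp_continuous_map)
      then show ?thesis
        unfolding h(2) by (rule image_compactin[OF K(1)])
    qed
  qed
  moreover have "c \<in> (\<Union>h\<in>?H. action_inv h ` K)" if "c \<in> C" for c
  proof -
    have c: "c \<in> topspace X"
      using that closedin_subset[OF C] by blast
    then obtain g k where gk: "g \<in> G" "k \<in> K" "c = g k"
      using K(2) by blast
    then have "action_inv g c = k"
      using inv_apply compactin_subset_topspace[OF K(1)] by blast
    then have "action_inv g \<in> ?H"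
      using inv_closed gk that by blast
    moreover have "action_inv (action_inv g) = g"
      using in_carrier[OF gk(1)] by simp
    ultimately show ?thesis
      using gk by (metis (no_types, lifting) UN_I imageI)
  qed
  then have "C \<subseteq> (\<Union>h\<in>?H. action_inv h ` K)"
    by (rule subsetI)
  ultimately show ?thesis
    using C by (rule closed_compactin)
qed

text \<open>
  If \<open>x\<close> lies in \<open>h C\<close>, then the translate \<open>h W\<close> is a neighbourhood of \<open>x\<close> meeting only
  finitely many \<open>g C\<close>, since \<open>h W\<close> meets \<open>g C\<close> only if \<open>W\<close> meets \<open>h\<^sup>-\<^sup>1 g W\<close>.
\<close>

lemma locally_finite_if_finitely_many_self_meetings:
  assumes cover: "(\<Union>g\<in>G. g ` C) = topspace X"
    and W: "openin X W" "C \<subseteq> W" and fin: "finite {g \<in> G. g ` W \<inter> W \<noteq> {}}"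
  shows "locally_finite_family X G (\<lambda>g. g ` C)"
  unfolding locally_finite_family_def
proof
  fix x assume "x \<in> topspace X"
  then obtain h where h: "h \<in> G" "x \<in> h ` C"
    using cover by blast
  have sub: "W \<subseteq> topspace X"
    using W(1) by (rule openin_subset)
  have "g \<in> (\<lambda>k. h \<cdot> k) ` {k \<in> G. k ` W \<inter> W \<noteq> {}}"
    if g: "g \<in> G" and meets: "h ` W \<inter> g ` C \<noteq> {}" for g
  proof -
    obtain w c where wc: "w \<in> W" "c \<in> C" "h w = g c"
      using meets by blast
    have "(action_inv h \<cdot> g) c = w"
      using mult_apply[OF inv_closed[OF h(1)] g] inv_apply[OF h(1)] wc W(2) sub
      by (metis subset_iff)
    then have "action_inv h \<cdot> g \<in> {k \<in> G. k ` W \<inter> W \<noteq> {}}"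
      using mult_closed[OF inv_closed[OF h(1)] g] wc W(2) by blast
    moreover have "g = h \<cdot> (action_inv h \<cdot> g)"
      using in_carrier[OF g] in_carrier[OF h(1)] by (simp add: Bij.m_assoc[symmetric])
    ultimately show ?thesis
      by (metis (no_types, lifting) imageI)
  qed
  then have "finite {g \<in> G. h ` W \<inter> g ` C \<noteq> {}}"
    by (intro finite_subset[OF _ finite_imageI[OF fin]]) blast
  moreover have "openin X (h ` W)"
    using homeomorphic_map_openness[OF homeomorphic[OF h(1)] sub] W(1) by simp
  ultimately show "\<exists>U. openin X U \<and> x \<in> U \<and> finite {g \<in> G. U \<inter> g ` C \<noteq> {}}"
    using h(2) W(2) by blast
qed

text \<open>
  Fix a point \<open>x\<close>. Neighbourhoods \<open>V\<^sub>y\<close> of finitely many \<open>y\<close> in \<open>C\<close> cover \<open>C\<close>; the intersection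
  \<open>N\<close> of the corresponding neighbourhoods \<open>U\<^sub>y\<close> of \<open>x\<close> has only finitely many translates \<open>g N\<close>
  meeting \<open>C\<close>. Since \<open>N\<close> meets \<open>g C\<close> exactly if \<open>g\<^sup>-\<^sup>1 N\<close> meets \<open>C\<close>, this is local finiteness at \<open>x\<close>.
\<close>

lemma properly_discontinuous_imp_locally_finite:
  assumes pd: "properly_discontinuous X G" and C: "compactin X C"
  shows "locally_finite_family X G (\<lambda>g. g ` C)"
  unfolding locally_finite_family_def
proof
  fix x assume x: "x \<in> topspace X"
  have sub: "C \<subseteq> topspace X"
    using C by (rule compactin_subset_topspace)
  define P where "P y U V \<longleftrightarrow> openin X U \<and> x \<in> U \<and> openin X V \<and> y \<in> V \<and>
      finite {g \<in> G. g ` U \<inter> V \<noteq> {}}" for y U V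
  have "\<exists>U V. P y U V" if "y \<in> C" for y
    using pd[unfolded properly_discontinuous_def, rule_format, OF x subsetD[OF sub that]]
    unfolding P_def .
  then obtain U V where UV: "\<And>y. y \<in> C \<Longrightarrow> P y (U y) (V y)"
    by metis
  have V: "openin X (V y) \<and> y \<in> V y" if "y \<in> C" for y
    using UV[OF that] by (simp add: P_def)
  obtain F where F: "finite F" "F \<subseteq> C" "C \<subseteq> (\<Union>y\<in>F. V y)"
    using compactin_finite_subcover[OF C V] .
  \<comment> \<open>The whole space is included because for empty \<open>F\<close> the bare intersection
      is \<open>UNIV\<close>, which need not be open in \<open>X\<close>.\<close>
  define N where "N = \<Inter>(insert (topspace X) (U ` F))"
  let ?K = "\<Union>y\<in>F. {g \<in> G. g ` U y \<inter> V y \<noteq> {}}"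
  have "openin X N"
    unfolding N_def by (rule openin_Inter) (use F(1,2) UV in \<open>auto simp: P_def\<close>)
  moreover have "x \<in> N"
    unfolding N_def using F(2) UV x by (auto simp: P_def)
  moreover have "finite {g \<in> G. N \<inter> g ` C \<noteq> {}}"
  proof (rule finite_subset)
    show "finite (action_inv ` ?K)"
      using F(1,2) UV by (auto simp: P_def)
    have "g \<in> action_inv ` ?K" if g: "g \<in> G" and meets: "N \<inter> g ` C \<noteq> {}" for g
    proof -
      obtain c where c: "c \<in> C" "g c \<in> N"
        using meets by blast
      then obtain y where y: "y \<in> F" "c \<in> V y"
        using F(3) by blast
      have "action_inv g (g c) = c"
        using inv_apply[OF g] c(1) sub by blast
      moreover have "g c \<in> U y"
        using c(2) y(1) by (simp add: N_def)
      ultimately have "action_inv g ` U y \<inter> V y \<noteq> {}"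
        using y(2) by (metis IntI empty_iff imageI)
      then have "action_inv g \<in> ?K"
        using inv_closed[OF g] y(1) by blast
      moreover have "g = action_inv (action_inv g)"
        using in_carrier[OF g] by simp
      ultimately show ?thesis
        by (rule rev_image_eqI[where f = action_inv])
    qed
    then show "{g \<in> G. N \<inter> g ` C \<noteq> {}} \<subseteq> action_inv ` ?K"
      by blast
  qed
  ultimately show "\<exists>U. openin X U \<and> x \<in> U \<and> finite {g \<in> G. U \<inter> g ` C \<noteq> {}}"
    by (intro exI conjI)
qed

end

section \<open>Locally finite fundamental regions\<close>

theorem theorem1p2:
  fixes X :: "'a topology" and G :: "('a \<Rightarrow> 'a) set" and R :: "'a set"
  assumes "locally_compact_space X"
    and "homeomorphism_group X G"
    and "compact_space (orbit_space X G)"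
    and "fundamental_region X G R"
  shows "(locally_finite_region X G R \<longleftrightarrow> strongly_locally_finite_region X G R) \<and>
         (strongly_locally_finite_region X G R \<longleftrightarrow>
            (\<exists>U. neighbourhood_of_set X (X closure_of R) U \<and> finite {g \<in> G. g ` U \<inter> U \<noteq> {}})) \<and>
         (locally_finite_region X G R \<longrightarrow> compactin X (X closure_of R)) \<and>
         (properly_discontinuous X G \<and> first_countable X \<and> Hausdorff_space X \<longrightarrow>
            compactin X (X closure_of R) \<longrightarrow> locally_finite_region X G R)"
proof -
  interpret homeomorphism_action X G
    by unfold_locales (rule assms(2))
  define C where "C = X closure_of R"
  have cover: "(\<Union>g\<in>G. g ` C) = topspace X"
    using assms(4) by (simp add: fundamental_region_def C_def)
  have C: "closedin X C" "C \<subseteq> topspace X"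
    by (simp_all add: C_def closure_of_subset_topspace)
  let ?lf = "locally_finite_family X G (\<lambda>g. g ` C)"
  let ?slf = "\<exists>U. openin X U \<and> C \<subseteq> U \<and> locally_finite_family X G (\<lambda>g. g ` U)"
  let ?nbhd = "\<exists>U. neighbourhood_of_set X C U \<and> finite {g \<in> G. g ` U \<inter> U \<noteq> {}}"

  have compact: "compactin X C" if ?lf
    using locally_finite_imp_compact[OF assms(1,3) C(1) that] .
  have lfD: "?slf \<and> ?nbhd" if lf: ?lf
  proof -
    obtain U L where UL: "openin X U" "compactin X L" "C \<subseteq> U" "U \<subseteq> L"
      using compact_neighbourhood_of_compact[OF assms(1) compact[OF lf]] .
    note finite_meet = finite_translates_between_compacts[OF cover C(2) lf UL(2)]
    have "\<exists>V. openin X V \<and> x \<in> V \<and> finite {g \<in> G. V \<inter> g ` U \<noteq> {}}"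
      if x: "x \<in> topspace X" for x
    proof -
      obtain V M where VM: "openin X V" "compactin X M" "x \<in> V" "V \<subseteq> M"
        using assms(1) x unfolding locally_compact_space_def by blast
      have "{g \<in> G. V \<inter> g ` U \<noteq> {}} \<subseteq> {g \<in> G. g ` L \<inter> M \<noteq> {}}"
        using UL(4) VM(4) by blast
      then have "finite {g \<in> G. V \<inter> g ` U \<noteq> {}}"
        using finite_meet[OF VM(2)] by (rule finite_subset)
      then show ?thesis
        using VM(1,3) by blast
    qed
    then have ?slf
      using UL(1,3) unfolding locally_finite_family_def by blast
    moreover have "{g \<in> G. g ` U \<inter> U \<noteq> {}} \<subseteq> {g \<in> G. g ` L \<inter> L \<noteq> {}}"
      using UL(4) by blast
    then have "finite {g \<in> G. g ` U \<inter> U \<noteq> {}}"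
      using finite_meet[OF UL(2)] by (rule finite_subset)
    then have ?nbhd
      using UL(1,3) openin_subset unfolding neighbourhood_of_set_def by blast
    ultimately show ?thesis ..
  qed
  have slfD: ?lf if ?slf
  proof -
    from that obtain U where U: "C \<subseteq> U" "locally_finite_family X G (\<lambda>g. g ` U)"
      by blast
    have "{g \<in> G. V \<inter> g ` C \<noteq> {}} \<subseteq> {g \<in> G. V \<inter> g ` U \<noteq> {}}" for V
      using U(1) by blast
    then show ?thesis
      using U(2) unfolding locally_finite_family_def by (meson finite_subset)
  qed
  have nbhdD: ?lf if ?nbhd
  proof -
    from that obtain U W where UW: "openin X W" "C \<subseteq> W" "W \<subseteq> U"
      and fin: "finite {g \<in> G. g ` U \<inter> U \<noteq> {}}"
      unfolding neighbourhood_of_set_def by blast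
    have "{g \<in> G. g ` W \<inter> W \<noteq> {}} \<subseteq> {g \<in> G. g ` U \<inter> U \<noteq> {}}"
      using UW(3) by blast
    then have "finite {g \<in> G. g ` W \<inter> W \<noteq> {}}"
      using fin by (rule finite_subset)
    then show ?thesis
      by (rule locally_finite_if_finitely_many_self_meetings[OF cover UW(1,2)])
  qed
  have "?lf \<longleftrightarrow> ?slf" "?slf \<longleftrightarrow> ?nbhd"
    using lfD slfD nbhdD by argo+
  moreover have "?lf \<longrightarrow> compactin X C"
    using compact by (rule impI)
  moreover have "properly_discontinuous X G \<and> first_countable X \<and> Hausdorff_space X \<longrightarrow>
      compactin X C \<longrightarrow> ?lf"
    by (intro impI, elim conjE) (rule properly_discontinuous_imp_locally_finite)
  ultimately show ?thesis
    unfolding locally_finite_region_def strongly_locally_finite_region_def C_def[symmetric]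
    by (intro conjI)
qed

end
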